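(* Let $\{X_{n,j}: j\in\mathbb{N}, n\in\mathbb{N}\}$ be an array of real random variables which are row-wise adapted to a sequence of filtrations $\{\{\mathcal{F}_{n,j}: j=0,1,\ldots\}: n\in\mathbb{N}\}$, and let $k_n\to\infty$ be a sequence of positive integers. Suppose that $$\sum_{j=1}^{k_n}\big|1-\mathbb{E}(e^{i\theta X_{n,j}}\mid\mathcal{F}_{n,j-1})\big|^2\longrightarrow 0\ \text{ in probability},\qquad\theta\in\mathbb{R}.$$ Let $A_n$ be arbitrary (real) random variables and, for each $\theta\in\mathbb{R}$, let $\Phi(\theta)\in\mathbb{C}$ be a constant. Then, for each $\theta\in\mathbb{R}$, the following conditions are equivalent: (a) $\displaystyle\Big(\sum_{j=1}^{k_n}\big(\mathbb{E}(e^{i\theta X_{n,j}}\mid\mathcal{F}_{n,j-1})-1\big)\Big)-i\theta A_n\longrightarrow\Phi(\theta)$ in probability; (b) $\displaystyle\Big(\prod_{j=1}^{k_n}\mathbb{E}(e^{i\theta X_{n,j}}\mid\mathcal{F}_{n,j-1})\Big)e^{-i\theta A_n}\longrightarrow e^{\Phi(\theta)}$ in probability. In either case also $$\mathbb{E}\exp\Big(i\theta\Big(\sum_{j=1}^{k_n}X_{n,j}-A_n\Big)\Big)\longrightarrow e^{\Phi(\theta)}.$$ In particular, if $e^{\Phi(\theta)}=\hat\mu(\theta)$, $\theta\in\mathbb{R}$, for some probability measure $\mu$ on $\mathbb{R}$, then either of conditions (a) or (b) (for all $\theta\in\mathbb{R}$) implies $$\sum_{j=1}^{k_n}X_{n,j}-A_n\longrightarrow\mu\quad\text{in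 distribution.}$$
   Context: Row-wise adapted means that for each $n$, $\mathcal{F}_{n,0}\subset\mathcal{F}_{n,1}\subset\cdots$ is a filtration and $X_{n,j}$ is $\mathcal{F}_{n,j}$-measurable for each $j\ge 1$. The random variables $A_n$ do not depend on $\theta$. $\hat\mu(\theta)=\int e^{i\theta x}\mu(dx)$ denotes the characteristic function of $\mu$.
   Formalization: Literal (b)⇒(a) fails (X=0, A=0, Φ=2πi), so (b) is shown equivalent to (a) modulo 2πi, i.e. after subtracting 2πi N_n with integer-valued random variables N_n; (a)⇒(b) and both limit conclusions are kept as stated. *)

theory Defs
  imports "HOL-Probability.Probability"
begin

definition tendsto_in_prob ::
    "'a measure \<Rightarrow> (nat \<Rightarrow> 'a \<Rightarrow> 'b::metric_space) \<Rightarrow> 'b \<Rightarrow> bool" where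
  "tendsto_in_prob M Y c \<longleftrightarrow>
     (\<forall>\<epsilon>>0. (\<lambda>n. measure M {\<omega> \<in> space M. dist (Y n \<omega>) c > \<epsilon>}) \<longlonglongrightarrow> 0)"

(* Convergence in probability modulo 2 pi i: Y n converges to c after subtracting suitable
   integer multiples of 2 pi i, which may depend on n and on the outcome.  Passing from
   convergence of products to convergence of sums takes a logarithm, so nothing better can be
   concluded: if all X and A are 0 and Phi = 2 pi i, then the products tend to 1 = exp Phi, but
   the sums do not tend to Phi.  Measurability of N matters: measure M gives 0 on non-measurable
   sets. *)
definition tendsto_in_prob_mod_2pii ::
    "'a measure \<Rightarrow> (nat \<Rightarrow> 'a \<Rightarrow> complex) \<Rightarrow> complex \<Rightarrow> bool" where
  "tendsto_in_prob_mod_2pii M Y c \<longleftrightarrow>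
     (\<exists>N :: nat \<Rightarrow> 'a \<Rightarrow> int. (\<forall>n. N n \<in> measurable M (count_space UNIV)) \<and>
        tendsto_in_prob M (\<lambda>n \<omega>. Y n \<omega> - 2 * complex_of_real pi * \<i> * of_int (N n \<omega>)) c)"

(* The library has conditional expectations of real functions only. *)
definition complex_cond_exp ::
    "'a measure \<Rightarrow> 'a measure \<Rightarrow> ('a \<Rightarrow> complex) \<Rightarrow> 'a \<Rightarrow> complex" where
  "complex_cond_exp M F f \<omega> =
     Complex (real_cond_exp M F (\<lambda>x. Re (f x)) \<omega>) (real_cond_exp M F (\<lambda>x. Im (f x)) \<omega>)"

definition cond_char ::
    "'a measure \<Rightarrow> 'a measure \<Rightarrow> ('a \<Rightarrow> real) \<Rightarrow> real \<Rightarrow> 'a \<Rightarrow> complex" where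
  "cond_char M F X \<theta> = complex_cond_exp M F (\<lambda>\<omega>. iexp (\<theta> * X \<omega>))"

end

(* If the conditional characteristic functions p_j are close to 1, the product of the p_j is the
   exponential of the sum of the p_j - 1 up to an error of order sum |p_j - 1|^2, so (a) and (b) are
   equivalent up to the choice of the logarithm.  For the limit of the characteristic functions, the
   quotients T_m of the products over j <= m of exp(i theta X_j) and of p_j form a martingale of
   mean 1, once they are stopped before the product of the p_j becomes smaller in modulus than
   half of |exp(Phi)|; the p_j are at most 1 in modulus, so (b) makes stopping unlikely, and without
   stopping exp(i theta (sum X_j - A)) differs from exp(Phi) T by T times the quantity that tends
   to 0 in (b). *)
theory Submission
  imports Defs
begin

section \<open>Convergence in probability, and logarithms near 1\<close>

text \<open>A union bound: \<open>W\<close> is far from \<open>c\<close> only where \<open>Y\<close>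
  or \<open>Z\<close> is far from its limit. The pointwise hypothesis is a continuity condition with
  \<open>\<delta>\<close> uniform in \<open>n\<close> and \<open>\<omega>\<close>; deterministic
  estimates enter through it.\<close>

lemma tendsto_in_prob_dominated:
  fixes Y :: "nat \<Rightarrow> 'a \<Rightarrow> 'b::{metric_space, second_countable_topology}"
    and Z :: "nat \<Rightarrow> 'a \<Rightarrow> 'c::{metric_space, second_countable_topology}"
  assumes "prob_space M"
    and [measurable]: "\<And>n. Y n \<in> borel_measurable M" "\<And>n. Z n \<in> borel_measurable M"
    and Y: "tendsto_in_prob M Y a" and Z: "tendsto_in_prob M Z b"
    and dom: "\<And>\<epsilon>. \<epsilon> > 0 \<Longrightarrow>
      \<exists>\<delta>>0. \<forall>n \<omega>. dist (Y n \<omega>) a \<le> \<delta> \<longrightarrow> dist (Z n \<omega>) b \<le> \<delta> \<longrightarrow> dist (W n \<omega>) c \<le> \<epsilon>"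
  shows "tendsto_in_prob M W c"
  unfolding tendsto_in_prob_def
proof (intro allI impI)
  interpret prob_space M by fact
  fix \<epsilon> :: real assume "\<epsilon> > 0"
  then obtain \<delta> where "\<delta> > 0"
    and \<delta>: "\<And>n \<omega>. dist (Y n \<omega>) a \<le> \<delta> \<Longrightarrow> dist (Z n \<omega>) b \<le> \<delta> \<Longrightarrow> dist (W n \<omega>) c \<le> \<epsilon>"
    using dom by meson
  let ?y = "\<lambda>n. measure M {\<omega> \<in> space M. dist (Y n \<omega>) a > \<delta>}"
  let ?z = "\<lambda>n. measure M {\<omega> \<in> space M. dist (Z n \<omega>) b > \<delta>}"
  let ?w = "\<lambda>n. measure M {\<omega> \<in> space M. dist (W n \<omega>) c > \<epsilon>}"
  have "?y \<longlonglongrightarrow> 0" "?z \<longlonglongrightarrow> 0"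
    using Y Z \<open>\<delta> > 0\<close> by (auto simp: tendsto_in_prob_def)
  then have lim: "(\<lambda>n. ?y n + ?z n) \<longlonglongrightarrow> 0"
    using tendsto_add by fastforce
  have "?w n \<le> ?y n + ?z n" for n
  proof -
    have "?w n \<le> measure M ({\<omega> \<in> space M. dist (Y n \<omega>) a > \<delta>} \<union> {\<omega> \<in> space M. dist (Z n \<omega>) b > \<delta>})"
    proof (rule finite_measure_mono)
      show "{\<omega> \<in> space M. dist (W n \<omega>) c > \<epsilon>} \<subseteq>
        {\<omega> \<in> space M. dist (Y n \<omega>) a > \<delta>} \<union> {\<omega> \<in> space M. dist (Z n \<omega>) b > \<delta>}"
        using \<delta> by (force simp: not_le[symmetric])
    qed measurable
    also have "\<dots> \<le> ?y n + ?z n"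
      by (rule measure_Un_le) measurable
    finally show ?thesis .
  qed
  then show "?w \<longlonglongrightarrow> 0"
    by (intro tendsto_sandwich[OF _ _ tendsto_const lim]) auto
qed

text \<open>Each summand is at most 1/4, so every factor lies within 1/2 of 1, where
  \<open>Ln (f i)\<close> differs from \<open>f i - 1\<close> by at most twice the squared distance.
  The remainder \<open>r\<close> collects these errors. The branch of the summed logarithms does not
  matter, since only the exponential of the sum is used.\<close>

lemma log_prod_near_sum:
  fixes f :: "'b \<Rightarrow> complex"
  assumes "finite I" and small: "(\<Sum>i\<in>I. (cmod (1 - f i))\<^sup>2) \<le> 1/4"
  obtains r where "(\<Prod>i\<in>I. f i) = exp ((\<Sum>i\<in>I. f i - 1) + r)"
    and "cmod r \<le> 2 * (\<Sum>i\<in>I. (cmod (1 - f i))\<^sup>2)"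
proof
  let ?r = "\<Sum>i\<in>I. Ln (1 + (f i - 1)) - (f i - 1)"
  have half: "cmod (f i - 1) \<le> 1/2" if "i \<in> I" for i
  proof (rule power2_le_imp_le)
    have "(cmod (f i - 1))\<^sup>2 \<le> (\<Sum>i\<in>I. (cmod (1 - f i))\<^sup>2)"
      using member_le_sum[OF that, of "\<lambda>i. (cmod (1 - f i))\<^sup>2"] \<open>finite I\<close>
      by (simp add: norm_minus_commute)
    then show "(cmod (f i - 1))\<^sup>2 \<le> (1/2)\<^sup>2"
      using small by (simp add: power2_eq_square)
  qed simp
  have "f i \<noteq> 0" if "i \<in> I" for i
    using half[OF that] by auto
  then have "(\<Prod>i\<in>I. f i) = (\<Prod>i\<in>I. exp (Ln (f i)))"
    by (intro prod.cong) auto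
  also have "\<dots> = exp (\<Sum>i\<in>I. Ln (f i))"
    using \<open>finite I\<close> by (simp add: exp_sum)
  also have "(\<Sum>i\<in>I. Ln (f i)) = (\<Sum>i\<in>I. f i - 1) + ?r"
    by (simp add: sum.distrib[symmetric])
  finally show "(\<Prod>i\<in>I. f i) = exp ((\<Sum>i\<in>I. f i - 1) + ?r)" .
  have "cmod (Ln (1 + (f i - 1)) - (f i - 1)) \<le> 2 * (cmod (1 - f i))\<^sup>2" if "i \<in> I" for i
  proof -
    have "cmod (Ln (1 + (f i - 1)) - (f i - 1)) \<le> (cmod (f i - 1))\<^sup>2 / (1 - cmod (f i - 1))"
      using half[OF that] by (intro Ln_approx_linear) auto
    also have "\<dots> \<le> (cmod (f i - 1))\<^sup>2 / (1/2)"
      using half[OF that] by (intro divide_left_mono) auto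
    finally show ?thesis
      by (simp add: norm_minus_commute)
  qed
  then show "cmod ?r \<le> 2 * (\<Sum>i\<in>I. (cmod (1 - f i))\<^sup>2)"
    by (simp add: sum_distrib_left sum_norm_le)
qed

text \<open>Continuity of \<open>Ln\<close> at 1, applied after shifting \<open>w\<close> into the
  principal strip. The multiple of the period is an explicit \<open>round\<close> expression so that
  it depends measurably on \<open>w\<close>.\<close>

lemma exp_near_one_imp_near_period:
  assumes "\<epsilon> > 0"
  obtains \<delta> where "\<delta> > 0"
    and "\<And>w. dist (exp w) 1 < \<delta> \<Longrightarrow>
      cmod (w - 2 * complex_of_real pi * \<i> * of_int (round (Im w / (2 * pi)))) < \<epsilon>"
proof -
  have "isCont Ln 1"
    by (simp add: continuous_at_Ln)
  then obtain d where "d > 0" and d: "\<And>z. dist z 1 < d \<Longrightarrow> cmod (Ln z) < \<epsilon>"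
    using \<open>\<epsilon> > 0\<close> unfolding continuous_at_eps_delta by (auto simp: dist_norm)
  show ?thesis
  proof
    \<comment> \<open>\<open>d\<close> comes from the continuity of \<open>Ln\<close>; the bound 1
      keeps \<open>exp w\<close> in the right half-plane, which rules out the boundary value
      \<open>Im v = - pi\<close> below.\<close>
    show "min d 1 > 0"
      using \<open>d > 0\<close> by simp
  next
    fix w :: complex assume near: "dist (exp w) 1 < min d 1"
    let ?N = "round (Im w / (2 * pi))"
    define v where "v = w - 2 * complex_of_real pi * \<i> * of_int ?N"
    have "exp v = exp w"
      unfolding exp_eq by (rule exI[of _ "- ?N"]) (simp add: v_def)
    have Im_v: "Im v = 2 * pi * (Im w / (2 * pi) - of_int ?N)"
      by (simp add: v_def field_simps)
    \<comment> \<open>The rounding error puts \<open>Im v\<close> between \<open>- pi\<close> and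
      \<open>pi\<close>; \<open>Ln\<close> inverts \<open>exp\<close> there except at
      \<open>- pi\<close>.\<close>
    have "\<bar>Im w / (2 * pi) - of_int ?N\<bar> \<le> 1/2"
      using of_int_round_abs_le[of "Im w / (2 * pi)"] by linarith
    then have "\<bar>Im v\<bar> \<le> 2 * pi * (1/2)"
      unfolding Im_v abs_mult by (intro mult_mono) auto
    moreover have "Im v \<noteq> - pi"
    proof
      assume "Im v = - pi"
      then have "Re (exp v) = - exp (Re v)"
        by (simp add: Re_exp)
      moreover have "\<bar>Re (exp v - 1)\<bar> < 1"
        using near abs_Re_le_cmod[of "exp v - 1"] by (simp add: \<open>exp v = exp w\<close> dist_norm)
      ultimately show False
        using exp_gt_zero[of "Re v"] by simp
    qed
    ultimately have "Ln (exp v) = v"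
      by (intro Ln_exp) auto
    then show "cmod v < \<epsilon>"
      using d[of "exp w"] near \<open>exp v = exp w\<close> by simp
  qed
qed

section \<open>Conditional expectations of complex functions\<close>

context
  fixes M F :: "'a measure"
  assumes prob: "prob_space M" and sub: "subalgebra M F"
begin

interpretation prob_space M by (rule prob)
interpretation finite_measure_subalgebra M F by unfold_locales (rule sub)

lemma borel_measurable_complex_cond_exp [measurable]:
  "complex_cond_exp M F f \<in> borel_measurable F"
  unfolding complex_cond_exp_def[abs_def] by (simp add: borel_measurable_complex_iff)

lemma integrable_complex_cond_exp:
  assumes "integrable M f"
  shows "integrable M (complex_cond_exp M F f)"
  proof -
  have "integrable M (\<lambda>x. of_real (real_cond_exp M F (\<lambda>x. Re (f x)) x) +
      \<i> * of_real (real_cond_exp M F (\<lambda>x. Im (f x)) x) :: complex)"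
    using assms by (intro Bochner_Integration.integrable_add integrable_mult_right integrable_of_real real_cond_exp_int)
      auto
  then show ?thesis
    by (simp add: complex_cond_exp_def[abs_def] Complex_eq)
qed

text \<open>Split \<open>W\<close> and \<open>f\<close> into real and imaginary parts: the identity
  for \<open>real_cond_exp\<close> applies to each of the four real products, and the bound on
  \<open>W\<close> makes every product integrable.\<close>

lemma integral_mult_complex_cond_exp:
  assumes f: "integrable M f" and W: "W \<in> borel_measurable F" and bound: "\<And>x. cmod (W x) \<le> B"
  shows "(LINT x|M. W x * complex_cond_exp M F f x) = (LINT x|M. W x * f x)"
proof -
  have [measurable]: "W \<in> borel_measurable M" "W \<in> borel_measurable F"
    using measurable_from_subalg[OF sub W] W by auto
  have WI: "integrable M (\<lambda>x. W x * g x)" if "integrable M g" for g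
    by (rule Bochner_Integration.integrable_bound[where f="\<lambda>x. B * cmod (g x)"])
       (use that bound in \<open>auto simp: norm_mult abs_mult intro!: mult_mono AE_I2 order.trans[OF bound abs_ge_self]\<close>)
  have real: "integrable M (\<lambda>x. u x * g x)"
      "integrable M (\<lambda>x. u x * real_cond_exp M F g x)"
      "(LINT x|M. u x * real_cond_exp M F g x) = (LINT x|M. u x * g x)"
    if g: "integrable M g" and u: "u \<in> borel_measurable F" "\<And>x. \<bar>u x\<bar> \<le> B" for u g :: "'a \<Rightarrow> real"
  proof -
    have [measurable]: "u \<in> borel_measurable M"
      using measurable_from_subalg[OF sub u(1)] .
    show "integrable M (\<lambda>x. u x * g x)"
      by (rule Bochner_Integration.integrable_bound[where f="\<lambda>x. B * \<bar>g x\<bar>"])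
        (use g u in \<open>auto simp: abs_mult intro!: mult_mono AE_I2 order.trans[OF u(2) abs_ge_self]\<close>)
    then show "integrable M (\<lambda>x. u x * real_cond_exp M F g x)"
      "(LINT x|M. u x * real_cond_exp M F g x) = (LINT x|M. u x * g x)"
      using real_cond_exp_intg[of u g] u g by auto
  qed
  have Re_le: "\<bar>Re (W x)\<bar> \<le> B" and Im_le: "\<bar>Im (W x)\<bar> \<le> B" for x
    using bound[of x] abs_Re_le_cmod[of "W x"] abs_Im_le_cmod[of "W x"] by linarith+
  have meas: "(\<lambda>x. Re (W x)) \<in> borel_measurable F" "(\<lambda>x. Im (W x)) \<in> borel_measurable F"
    by measurable
  have int: "integrable M (\<lambda>x. Re (f x))" "integrable M (\<lambda>x. Im (f x))"
    using f by auto
  note R = real[OF int(1) meas(1) Re_le] real[OF int(2) meas(1) Re_le]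
    real[OF int(1) meas(2) Im_le] real[OF int(2) meas(2) Im_le]
  note I = WI[OF f] WI[OF integrable_complex_cond_exp[OF f]]
  show ?thesis
    by (rule complex_eqI; simp only: integral_Re[symmetric] integral_Im[symmetric] I)
       (simp_all add: complex_cond_exp_def R)
qed

text \<open>Bounding the real and imaginary parts separately would only give the square root of 2.
  The sharp constant 1 is what makes the moduli of the partial products of conditional
  characteristic functions decrease.\<close>

lemma cmod_complex_cond_exp_le_1:
  assumes f: "f \<in> borel_measurable M" and bound: "\<And>x. cmod (f x) \<le> 1"
  shows "AE x in M. cmod (complex_cond_exp M F f x) \<le> 1"
proof -
  define g where "g = complex_cond_exp M F f"
  define B where "B = {x \<in> space M. cmod (g x) > 1}"
  \<comment> \<open>Testing against the conjugate phase of g on B turns the defining identity into a bound on |g|.\<close>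
  define W where "W x = indicator B x * cnj (g x) / of_real (cmod (g x))" for x
  have intf: "integrable M f"
    using f bound by (intro integrable_const_bound[where B=1]) auto
  have intg: "integrable M g"
    unfolding g_def by (rule integrable_complex_cond_exp[OF intf])
  have gF [measurable]: "g \<in> borel_measurable F"
    unfolding g_def by measurable
  have "space F = space M" using sub by (simp add: subalgebra_def)
  then have "B = {x \<in> space F. cmod (g x) > 1}"
    by (simp add: B_def)
  also have "\<dots> \<in> sets F"
    by measurable
  finally have BF [measurable]: "B \<in> sets F" .
  have BM [measurable]: "B \<in> sets M"
    using BF sub by (auto simp: subalgebra_def)
  have intB: "integrable M (indicat_real B)"
    by (intro integrable_const_bound[where B=1]) auto
  have WF: "W \<in> borel_measurable F"
  proof -
    have [measurable]: "cnj \<in> borel_measurable borel" "complex_of_real \<in> borel_measurable borel"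
      by (intro borel_measurable_continuous_onI continuous_intros)+
    show ?thesis
      unfolding W_def by measurable
  qed
  have W1: "cmod (W x) \<le> 1" for x
    by (simp add: W_def norm_mult indicator_def norm_divide divide_le_eq_1)
  have Wg: "W x * g x = of_real (indicator B x * cmod (g x))" for x
    by (simp add: W_def indicator_def mult.commute[of "cnj _"] complex_norm_square[symmetric] power2_eq_square)
  have Wf: "cmod (W x * f x) \<le> indicator B x" for x
    using bound[of x] by (auto simp: W_def norm_mult indicator_def norm_divide divide_le_eq_1)
  have "(LINT x|M. indicator B x * cmod (g x)) = Re (LINT x|M. W x * g x)"
    unfolding Wg by (simp only: integral_complex_of_real Re_complex_of_real)
  also have "\<dots> = Re (LINT x|M. W x * f x)"
    using integral_mult_complex_cond_exp[OF intf WF W1] by (simp add: g_def)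
  also have "\<dots> \<le> (LINT x|M. cmod (W x * f x))"
    using complex_Re_le_cmod integral_norm_bound order.trans by blast
  also have "\<dots> \<le> (LINT x|M. indicator B x)"
  proof (rule integral_mono)
    show "integrable M (\<lambda>x. cmod (W x * f x))"
      using f measurable_from_subalg[OF sub WF]
      by (intro integrable_norm integrable_const_bound[where B=1] AE_I2)
        (auto intro!: order.trans[OF Wf] simp: indicator_def)
  qed (use intB Wf in auto)
  finally have le: "(LINT x|M. indicator B x * cmod (g x)) \<le> (LINT x|M. indicator B x)" .
  have int: "integrable M (\<lambda>x. indicator B x * cmod (g x))"
    using integrable_mult_indicator[OF BM integrable_norm[OF intg]] by simp
  \<comment> \<open>The integrand is nonnegative, and positive exactly on \<open>B\<close>. By
    \<open>le\<close> its integral is at most 0, so \<open>B\<close> is a null set.\<close>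
  have "(LINT x|M. indicator B x * cmod (g x) - indicator B x) = 0"
  proof (rule antisym)
    show "0 \<le> (LINT x|M. indicator B x * cmod (g x) - indicator B x)"
      by (rule integral_nonneg_AE) (auto simp: B_def indicator_def)
  qed (use le int intB in simp)
  then have "AE x in M. indicator B x * cmod (g x) - indicator B x = (0::real)"
    by (subst (asm) integral_nonneg_eq_0_iff_AE[OF Bochner_Integration.integrable_diff[OF int intB]])
      (auto simp: B_def indicator_def)
  then show ?thesis
    by (rule AE_mp) (auto simp: B_def indicator_def g_def intro!: AE_I2 split: if_splits)
qed

end

section \<open>Convergence of sums modulo 2 pi i and of products\<close>

text \<open>Where the sum of squares is at most 1/4, the product term is \<open>exp (S + r)\<close>
  with \<open>r\<close> small. From sums to products, the multiples of the period vanish under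
  \<open>exp\<close>; in the other direction, rounding supplies them.\<close>

lemma sum_mod_2pii_iff_prod_tendsto_in_prob:
  fixes f :: "nat \<Rightarrow> 'b \<Rightarrow> 'a \<Rightarrow> complex"
  assumes "prob_space M" and fin: "\<And>n. finite (I n)"
    and f [measurable]: "\<And>n i. f n i \<in> borel_measurable M"
    and a [measurable]: "\<And>n. a n \<in> borel_measurable M"
    and small: "tendsto_in_prob M (\<lambda>n \<omega>. \<Sum>i\<in>I n. (cmod (1 - f n i \<omega>))\<^sup>2) 0"
  shows "tendsto_in_prob_mod_2pii M (\<lambda>n \<omega>. (\<Sum>i\<in>I n. f n i \<omega> - 1) - a n \<omega>) c \<longleftrightarrow>
    tendsto_in_prob M (\<lambda>n \<omega>. (\<Prod>i\<in>I n. f n i \<omega>) * exp (- a n \<omega>)) (exp c)"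
    (is "tendsto_in_prob_mod_2pii M ?S c \<longleftrightarrow> tendsto_in_prob M ?P (exp c)")
proof
  let ?Q = "\<lambda>n \<omega>. \<Sum>i\<in>I n. (cmod (1 - f n i \<omega>))\<^sup>2"
  have P_eq: "\<exists>r. ?P n \<omega> = exp (?S n \<omega> + r) \<and> cmod r \<le> 2 * \<delta>"
    if "dist (?Q n \<omega>) 0 \<le> \<delta>" "\<delta> \<le> 1/4" for n \<omega> \<delta>
  proof -
    have "?Q n \<omega> \<le> \<delta>"
      using that(1) by (simp add: sum_nonneg)
    moreover from this that(2) have "?Q n \<omega> \<le> 1/4"
      by linarith
    then obtain r where "(\<Prod>i\<in>I n. f n i \<omega>) = exp ((\<Sum>i\<in>I n. f n i \<omega> - 1) + r)" "cmod r \<le> 2 * ?Q n \<omega>"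
      using log_prod_near_sum[OF fin[of n], of "\<lambda>i. f n i \<omega>"] by blast
    ultimately show ?thesis
      by (intro exI[of _ r]) (auto simp: exp_add exp_diff exp_minus field_simps)
  qed
  {
    assume "tendsto_in_prob_mod_2pii M ?S c"
    then obtain N :: "nat \<Rightarrow> 'a \<Rightarrow> int" where [measurable]: "\<And>n. N n \<in> measurable M (count_space UNIV)"
      and lim: "tendsto_in_prob M (\<lambda>n \<omega>. ?S n \<omega> - 2 * complex_of_real pi * \<i> * of_int (N n \<omega>)) c"
      unfolding tendsto_in_prob_mod_2pii_def by blast
    show "tendsto_in_prob M ?P (exp c)"
    proof (rule tendsto_in_prob_dominated[OF \<open>prob_space M\<close> _ _ small lim])
      fix \<epsilon> :: real assume "\<epsilon> > 0"
      moreover have "isCont exp c"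
        by simp
      ultimately obtain d where "d > 0" and d: "\<And>u. dist u c < d \<Longrightarrow> dist (exp u) (exp c) < \<epsilon>"
        unfolding continuous_at_eps_delta by metis
      show "\<exists>\<delta>>0. \<forall>n \<omega>. dist (?Q n \<omega>) 0 \<le> \<delta> \<longrightarrow>
          dist (?S n \<omega> - 2 * complex_of_real pi * \<i> * of_int (N n \<omega>)) c \<le> \<delta> \<longrightarrow>
          dist (?P n \<omega>) (exp c) \<le> \<epsilon>"
      \<comment> \<open>1/4 is the threshold in \<open>P_eq\<close>. With \<open>d/4\<close> the
        remainder \<open>r\<close> is at most \<open>d/2\<close> and \<open>Z\<close> is within
        \<open>d/4\<close> of \<open>c\<close>, which stays below \<open>d\<close> in total.\<close>
      proof (intro exI[of _ "min (1/4) (d/4)"] conjI allI impI)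
        fix n \<omega>
        define Z where "Z = ?S n \<omega> - 2 * complex_of_real pi * \<i> * of_int (N n \<omega>)"
        assume Q: "dist (?Q n \<omega>) 0 \<le> min (1/4) (d/4)"
          and "dist (?S n \<omega> - 2 * complex_of_real pi * \<i> * of_int (N n \<omega>)) c \<le> min (1/4) (d/4)"
        then have Z: "dist Z c \<le> d/4"
          by (simp add: Z_def)
        obtain r where r: "?P n \<omega> = exp (?S n \<omega> + r)" "cmod r \<le> 2 * min (1/4) (d/4)"
          using P_eq[OF Q min.cobounded1] by blast
        have "dist (Z + r) c \<le> dist Z c + cmod r"
          using norm_triangle_ineq[of "Z - c" r] by (simp add: dist_norm algebra_simps)
        then have "dist (Z + r) c < d"
          using r(2) Z \<open>d > 0\<close> by linarith
        moreover have "exp (?S n \<omega> + r) = exp (Z + r)"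
          unfolding exp_eq by (rule exI[of _ "N n \<omega>"]) (simp add: Z_def)
        ultimately show "dist (?P n \<omega>) (exp c) \<le> \<epsilon>"
          using d r(1) by (simp add: less_imp_le)
      qed (use \<open>d > 0\<close> in auto)
    qed measurable
  next
    assume lim: "tendsto_in_prob M ?P (exp c)"
    \<comment> \<open>The deviation from \<open>c\<close> is rounded, rather than the sum itself,
      because \<open>exp (S - c)\<close> is the quantity that gets close to 1.\<close>
    define N where "N n \<omega> = round (Im (?S n \<omega> - c) / (2 * pi))" for n \<omega>
    have "N n \<in> measurable M (count_space UNIV)" for n
      unfolding N_def round_def by measurable
    moreover have "tendsto_in_prob M (\<lambda>n \<omega>. ?S n \<omega> - 2 * complex_of_real pi * \<i> * of_int (N n \<omega>)) c"
    proof (rule tendsto_in_prob_dominated[OF \<open>prob_space M\<close> _ _ small lim])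
      fix \<epsilon> :: real assume "\<epsilon> > 0"
      then obtain \<eta> where "\<eta> > 0" and \<eta>: "\<And>w. dist (exp w) 1 < \<eta> \<Longrightarrow>
          cmod (w - 2 * complex_of_real pi * \<i> * of_int (round (Im w / (2 * pi)))) < \<epsilon>"
        by (rule exp_near_one_imp_near_period) blast
      \<comment> \<open>This function is 1 at \<open>(exp c, 0)\<close>, and at
        \<open>(P, r)\<close> with \<open>P = exp (S + r)\<close> it equals
        \<open>exp (S - c)\<close>. Joint continuity handles the errors of \<open>P\<close> and
        \<open>r\<close> at once.\<close>
      have "isCont (\<lambda>x. fst x * exp (- snd x) * exp (- c)) (exp c, 0)"
        by (intro continuous_intros)
      then obtain d where "d > 0" and d: "\<And>p r. dist (p, r) (exp c, 0) < d \<Longrightarrow>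
          dist (p * exp (- r) * exp (- c)) 1 < \<eta>"
        unfolding continuous_at_eps_delta using \<open>\<eta> > 0\<close> by (force simp: exp_minus)
      show "\<exists>\<delta>>0. \<forall>n \<omega>. dist (?Q n \<omega>) 0 \<le> \<delta> \<longrightarrow> dist (?P n \<omega>) (exp c) \<le> \<delta> \<longrightarrow>
          dist (?S n \<omega> - 2 * complex_of_real pi * \<i> * of_int (N n \<omega>)) c \<le> \<epsilon>"
      proof (intro exI[of _ "min (1/4) (d/4)"] conjI allI impI)
        fix n \<omega>
        assume Q: "dist (?Q n \<omega>) 0 \<le> min (1/4) (d/4)"
          and P: "dist (?P n \<omega>) (exp c) \<le> min (1/4) (d/4)"
        obtain r where r: "?P n \<omega> = exp (?S n \<omega> + r)" "cmod r \<le> 2 * min (1/4) (d/4)"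
          using P_eq[OF Q min.cobounded1] by blast
        have "dist (?P n \<omega>, r) (exp c, 0) \<le> dist (?P n \<omega>) (exp c) + cmod r"
          by (simp add: dist_Pair_Pair sqrt_sum_squares_le_sum)
        then have "dist (?P n \<omega> * exp (- r) * exp (- c)) 1 < \<eta>"
          using P r(2) \<open>d > 0\<close> by (intro d) linarith
        moreover have "?P n \<omega> * exp (- r) * exp (- c) = exp (?S n \<omega> - c)"
          unfolding r(1) by (simp add: exp_add[symmetric])
        ultimately have "cmod (?S n \<omega> - c - 2 * complex_of_real pi * \<i> * of_int (N n \<omega>)) < \<epsilon>"
          unfolding N_def by (intro \<eta>) simp
        then show "dist (?S n \<omega> - 2 * complex_of_real pi * \<i> * of_int (N n \<omega>)) c \<le> \<epsilon>"
          by (simp add: dist_norm algebra_simps)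
      qed (use \<open>d > 0\<close> in auto)
    qed measurable
    ultimately show "tendsto_in_prob_mod_2pii M ?S c"
      unfolding tendsto_in_prob_mod_2pii_def by blast
  }
qed

section \<open>Characteristic functions of the row sums\<close>

text \<open>An estimate for a single row, with \<open>z\<close> in the role of
  \<open>exp (\<Phi> \<theta>)\<close>. Since the stopped quotient \<open>T m\<close> has mean 1,
  the left side is the modulus of the mean of \<open>U - z * T m\<close>. This difference is at most
  \<open>2 * \<epsilon> / cmod z\<close> off the exceptional event and at most
  \<open>3 + cmod z\<close> on it.\<close>

lemma char_sum_near:
  fixes M :: "'a measure" and F :: "nat \<Rightarrow> 'a measure" and X :: "nat \<Rightarrow> 'a \<Rightarrow> real"
    and z :: complex and \<theta> :: real
  defines "p \<equiv> \<lambda>j. cond_char M (F (j - 1)) (X j) \<theta>"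
  assumes prob: "prob_space M" and filt: "filtration (space M) F" and sub: "\<And>j. subalgebra M (F j)"
    and X: "\<And>j. j \<ge> 1 \<Longrightarrow> X j \<in> borel_measurable (F j)"
    and A [measurable]: "A \<in> borel_measurable M"
    and \<epsilon>: "\<epsilon> > 0" "\<epsilon> \<le> cmod z / 2"
  shows "cmod ((LINT \<omega>|M. iexp (\<theta> * ((\<Sum>j=1..m. X j \<omega>) - A \<omega>))) - z) \<le> 2 * \<epsilon> / cmod z +
    (3 + cmod z) * measure M {\<omega> \<in> space M.
      dist ((\<Prod>j=1..m. p j \<omega>) * exp (- (\<i> * of_real (\<theta> * A \<omega>)))) z > \<epsilon>}"
proof -
  interpret prob_space M by (rule prob)
  define c where "c = cmod z / 2"
  define e where "e j \<omega> = iexp (\<theta> * X j \<omega>)" for j \<omega>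
  \<comment> \<open>All partial products up to \<open>m\<close> are tested, since their moduli
    decrease only almost everywhere; this way the bounds on \<open>T\<close> hold at every
    point.\<close>
  define ok where "ok m \<omega> \<longleftrightarrow> (\<forall>i\<in>{1..m}. c \<le> cmod (\<Prod>j=1..i. p j \<omega>))" for m \<omega>
  \<comment> \<open>Whether the j-th factor is included is known at time j - 1, which keeps T a martingale.\<close>
  define T where "T m \<omega> = (\<Prod>j=1..m. if ok j \<omega> then e j \<omega> / p j \<omega> else 1)" for m \<omega>
  \<comment> \<open>The factors \<open>e j\<close> have modulus 1, so before stopping
    \<open>T\<close> is bounded by \<open>1 / c\<close>; the 1 covers the empty product.\<close>
  define B where "B = max 1 (1 / c)"
  have "c > 0" "z \<noteq> 0" "B \<ge> 0"
    using \<epsilon> by (auto simp: c_def B_def)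
  have mono: "f \<in> borel_measurable (F j)" if "f \<in> borel_measurable (F i)" "i \<le> j"
    for f :: "'a \<Rightarrow> 'z::topological_space" and i j
  proof (rule measurable_from_subalg[OF _ that(1)])
    show "subalgebra (F j) (F i)"
      using filtration.sets_F_mono[OF filt that(2)] filtration.space_F[OF filt]
      by (simp add: subalgebra_def)
  qed
  note toM = measurable_from_subalg[OF sub]
  have pF: "p j \<in> borel_measurable (F (j - 1))" for j
    unfolding p_def cond_char_def by (rule borel_measurable_complex_cond_exp[OF prob sub])
  have eF: "e j \<in> borel_measurable (F j)" if "j \<ge> 1" for j
    using X[OF that] unfolding e_def by measurable
  have norm_e [simp]: "cmod (e j \<omega>) = 1" for j \<omega>
    by (simp add: e_def)
  have norm_prod_e [simp]: "cmod (\<Prod>j=1..m. e j \<omega>) = 1" for m \<omega>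
    by (simp add: prod_norm[symmetric])
  have int_e: "integrable M (e j)" if "j \<ge> 1" for j
    using toM[OF eF[OF that]] by (intro integrable_const_bound[where B=1]) auto
  \<comment> \<open>The index shift is right because \<open>p (Suc m)\<close> conditions on
    \<open>F m\<close>.\<close>
  have okF: "Measurable.pred (F m) (ok (Suc m))" for m
  proof -
    have [measurable]: "p j \<in> borel_measurable (F m)" if "j \<in> {1..i}" "i \<in> {1..Suc m}" for i j
      using that by (intro mono[OF pF]) auto
    show ?thesis
      unfolding ok_def by measurable
  qed
  have ok_mono: "ok i \<omega>" if "ok j \<omega>" "i \<le> j" for i j \<omega>
    using that by (auto simp: ok_def)
  have TF: "T m \<in> borel_measurable (F m)" for m
    unfolding T_def
  proof (rule borel_measurable_prod)
    fix j assume j: "j \<in> {1..m}"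
    have [measurable]: "p j \<in> borel_measurable (F m)" "e j \<in> borel_measurable (F m)"
      using j mono[OF pF[of j]] mono[OF eF[of j]] by auto
    have "j - 1 \<le> m"
      using j by auto
    then have "Measurable.pred (F m) (ok j)"
      using okF[of "j - 1"] j filtration.sets_F_mono[OF filt] filtration.space_F[OF filt]
      by (fastforce simp: pred_def)
    then show "(\<lambda>\<omega>. if ok j \<omega> then e j \<omega> / p j \<omega> else 1) \<in> borel_measurable (F m)"
      by measurable
  qed
  have T_ok: "T m \<omega> = (\<Prod>j=1..m. e j \<omega>) / (\<Prod>j=1..m. p j \<omega>)" if "ok m \<omega>" for m \<omega>
    unfolding T_def prod_dividef[symmetric] using that ok_mono by (intro prod.cong) auto
  have T_bound: "cmod (T m \<omega>) \<le> B" for m \<omega>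
  proof (induction m)
    case 0
    then show ?case by (simp add: T_def B_def)
  next
    case (Suc m)
    show ?case
    proof (cases "ok (Suc m) \<omega>")
      case True
      then have "c \<le> cmod (\<Prod>j=1..Suc m. p j \<omega>)"
        unfolding ok_def by (rule bspec) simp
      then have "1 / cmod (\<Prod>j=1..Suc m. p j \<omega>) \<le> 1 / c"
        using \<open>c > 0\<close> by (intro frac_le) auto
      moreover have "cmod (T (Suc m) \<omega>) = 1 / cmod (\<Prod>j=1..Suc m. p j \<omega>)"
        unfolding T_ok[OF True] norm_divide norm_prod_e ..
      ultimately show ?thesis
        by (simp add: B_def)
    qed (use Suc in \<open>simp add: T_def\<close>)
  qed
  have intT: "integrable M (T m)" for m
    using toM[OF TF] T_bound by (intro integrable_const_bound[where B=B]) auto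
  have ET: "(LINT \<omega>|M. T m \<omega>) = 1" for m
  proof (induction m)
    case 0
    then show ?case by (simp add: T_def prob_space)
  next
    case (Suc m)
    \<comment> \<open>The coefficient of the martingale increment:
      \<open>T (Suc m) - T m = W * (e (Suc m) - p (Suc m))\<close>, with \<open>W = 0\<close> once
      stopped. It is \<open>F m\<close>-measurable, so \<open>e\<close> may be replaced by
      \<open>p\<close> under the integral.\<close>
    define W where "W \<omega> = (if ok (Suc m) \<omega> then T m \<omega> / p (Suc m) \<omega> else 0)" for \<omega>
    have [measurable]: "p (Suc m) \<in> borel_measurable (F m)" "T m \<in> borel_measurable (F m)"
        "Measurable.pred (F m) (ok (Suc m))"
      using pF[of "Suc m"] TF okF by auto
    have WF: "W \<in> borel_measurable (F m)"
      unfolding W_def by measurable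
    have We: "W \<omega> * e (Suc m) \<omega> = T (Suc m) \<omega> - (if ok (Suc m) \<omega> then 0 else T m \<omega>)" for \<omega>
      by (simp add: W_def T_def)
    have Wp: "W \<omega> * p (Suc m) \<omega> = T m \<omega> - (if ok (Suc m) \<omega> then 0 else T m \<omega>)" for \<omega>
    proof (cases "ok (Suc m) \<omega>")
      case True
      then have "c \<le> cmod (\<Prod>j=1..Suc m. p j \<omega>)"
        unfolding ok_def by (rule bspec) simp
      then have "p (Suc m) \<omega> \<noteq> 0"
        using \<open>c > 0\<close> by auto
      then show ?thesis
        by (simp add: W_def)
    qed (simp add: W_def)
    have W_le: "cmod (W \<omega>) \<le> B" for \<omega>
    proof -
      \<comment> \<open>Multiplying by \<open>e\<close>, of modulus 1, turns \<open>W\<close> into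
        \<open>T (Suc m)\<close> or 0, so the bound on \<open>T\<close> applies.\<close>
      have "cmod (W \<omega>) = cmod (W \<omega> * e (Suc m) \<omega>)"
        by (simp add: norm_mult)
      also have "\<dots> \<le> B"
        unfolding We using T_bound[of "Suc m" \<omega>] \<open>B \<ge> 0\<close> by (auto simp: T_def)
      finally show ?thesis .
    qed
    have "(LINT \<omega>|M. W \<omega> * p (Suc m) \<omega>) = (LINT \<omega>|M. W \<omega> * e (Suc m) \<omega>)"
      using integral_mult_complex_cond_exp[OF prob sub int_e[of "Suc m"] WF W_le]
      by (simp add: p_def cond_char_def e_def[abs_def])
    moreover have "integrable M (\<lambda>\<omega>. if ok (Suc m) \<omega> then 0 else T m \<omega>)"
    proof (rule integrable_const_bound[where B=B])
      show "(\<lambda>\<omega>. if ok (Suc m) \<omega> then 0 else T m \<omega>) \<in> borel_measurable M"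
        by (rule measurable_from_subalg[OF sub[of m]]) measurable
    qed (use T_bound \<open>B \<ge> 0\<close> in auto)
    ultimately show ?case
      unfolding We Wp using intT Suc by simp
  qed

  have [measurable]: "p j \<in> borel_measurable M" for j
    by (rule toM[OF pF])
  define P where "P \<omega> = (\<Prod>j=1..m. p j \<omega>) * exp (- (\<i> * of_real (\<theta> * A \<omega>)))" for \<omega>
  define D where "D = {\<omega> \<in> space M. dist (P \<omega>) z > \<epsilon>}"
  define U where "U \<omega> = iexp (\<theta> * ((\<Sum>j=1..m. X j \<omega>) - A \<omega>))" for \<omega>
  have [measurable]: "P \<in> borel_measurable M"
    unfolding P_def by measurable
  have [measurable]: "D \<in> sets M"
    unfolding D_def by measurable
  have XM: "X j \<in> borel_measurable M" if "j \<in> {1..m}" for j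
    using that by (intro toM[OF X]) auto
  have "(\<lambda>\<omega>. \<Sum>j=1..m. X j \<omega>) \<in> borel_measurable M"
    by (rule borel_measurable_sum[OF XM])
  then have [measurable]: "U \<in> borel_measurable M"
    unfolding U_def by measurable
  have norm_U: "cmod (U \<omega>) = 1" for \<omega>
    by (simp add: U_def)
  have intU: "integrable M U"
    using norm_U by (intro integrable_const_bound[where B=1]) auto
  have U_eq: "U \<omega> = (\<Prod>j=1..m. e j \<omega>) * exp (- (\<i> * of_real (\<theta> * A \<omega>)))" for \<omega>
    by (simp add: U_def e_def exp_sum[symmetric] exp_add[symmetric] sum_distrib_left algebra_simps)
  have "AE \<omega> in M. \<forall>j. j \<ge> 1 \<longrightarrow> cmod (p j \<omega>) \<le> 1"
    unfolding AE_all_countable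
  proof (intro allI)
    fix j
    show "AE \<omega> in M. j \<ge> 1 \<longrightarrow> cmod (p j \<omega>) \<le> 1"
      using cmod_complex_cond_exp_le_1[OF prob sub, of "e j" "j - 1"] toM[OF eF[of j]]
      by (cases "j \<ge> 1") (auto simp: p_def cond_char_def e_def[abs_def])
  qed
  then have AE_bound: "AE \<omega> in M. cmod (U \<omega> - z * T m \<omega>) \<le> 2 * \<epsilon> / cmod z + (3 + cmod z) * indicator D \<omega>"
  proof (rule AE_mp, intro AE_I2 impI)
    fix \<omega> assume "\<omega> \<in> space M" and le1: "\<forall>j. j \<ge> 1 \<longrightarrow> cmod (p j \<omega>) \<le> 1"
    show "cmod (U \<omega> - z * T m \<omega>) \<le> 2 * \<epsilon> / cmod z + (3 + cmod z) * indicator D \<omega>"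
    proof (cases "\<omega> \<in> D")
      case True
      \<comment> \<open>On the exceptional event only the bounds on \<open>U\<close> and
        \<open>T\<close> are available; \<open>cmod z / c = 2\<close> yields the constant.\<close>
      have "cmod (U \<omega> - z * T m \<omega>) \<le> 1 + cmod z * B"
        using norm_triangle_ineq4[of "U \<omega>" "z * T m \<omega>"] mult_left_mono[OF T_bound[of m \<omega>], of "cmod z"]
        by (simp add: norm_U norm_mult)
      also have "\<dots> \<le> 1 + cmod z * (1 + 1 / c)"
        using \<open>c > 0\<close> by (intro add_left_mono mult_left_mono) (auto simp: B_def)
      also have "\<dots> = 3 + cmod z"
        using \<open>z \<noteq> 0\<close> by (simp add: c_def field_simps)
      finally show ?thesis
        using True \<epsilon> by (simp add: add_increasing)
    next
      case False
      then have near: "dist (P \<omega>) z \<le> \<epsilon>"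
        using \<open>\<omega> \<in> space M\<close> by (simp add: D_def)
      let ?\<Pi> = "\<lambda>i. \<Prod>j=1..i. p j \<omega>"
      have norm_P: "cmod (P \<omega>) = cmod (?\<Pi> m)"
        by (simp add: P_def norm_mult)
      have "cmod z \<le> cmod (P \<omega>) + dist (P \<omega>) z"
        using norm_triangle_ineq2[of z "P \<omega>"] by (simp add: dist_norm norm_minus_commute)
      then have large: "c \<le> cmod (?\<Pi> m)"
        using near \<epsilon> unfolding norm_P c_def by linarith
      \<comment> \<open>Factors of modulus at most 1 carry the lower bound for the full product back
        to every partial product, so no stopping occurs off \<open>D\<close>.\<close>
      have "cmod (?\<Pi> (Suc i)) \<le> cmod (?\<Pi> i)" for i
        using le1 by (simp add: norm_mult mult_left_le)
      then have "cmod (?\<Pi> m) \<le> cmod (?\<Pi> i)" if "i \<le> m" for i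
        using lift_Suc_antimono_le[of "\<lambda>i. cmod (?\<Pi> i)"] that by blast
      then have "ok m \<omega>"
        using large unfolding ok_def by (meson atLeastAtMost_iff order_trans)
      have "?\<Pi> m \<noteq> 0"
        using large \<open>c > 0\<close> norm_zero by (metis not_le)
      \<comment> \<open>\<open>U\<close> and \<open>P\<close> share the factor containing
        \<open>A\<close>, hence \<open>U = T m * P\<close> here.\<close>
      then have "U \<omega> - z * T m \<omega> = (\<Prod>j=1..m. e j \<omega>) / ?\<Pi> m * (P \<omega> - z)"
        unfolding T_ok[OF \<open>ok m \<omega>\<close>] U_eq P_def by (simp add: field_simps)
      then have "cmod (U \<omega> - z * T m \<omega>) = dist (P \<omega>) z / cmod (?\<Pi> m)"
        by (simp only: norm_mult norm_divide norm_prod_e dist_norm) simp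
      also have "\<dots> \<le> \<epsilon> / c"
        using near large \<epsilon> \<open>c > 0\<close> by (intro frac_le) auto
      finally show ?thesis
        using False by (simp add: c_def mult.commute)
    qed
  qed
  have indD: "integrable M (indicat_real D)"
    by (intro integrable_const_bound[where B=1]) auto
  then have intD: "integrable M (\<lambda>\<omega>. 2 * \<epsilon> / cmod z + (3 + cmod z) * indicator D \<omega>)"
    by (intro Bochner_Integration.integrable_add integrable_mult_right) auto
  have "(LINT \<omega>|M. U \<omega>) - z = (LINT \<omega>|M. U \<omega> - z * T m \<omega>)"
    using intU intT ET by simp
  then have "cmod ((LINT \<omega>|M. U \<omega>) - z) \<le> (LINT \<omega>|M. cmod (U \<omega> - z * T m \<omega>))"
    by simp
  also have "\<dots> \<le> (LINT \<omega>|M. 2 * \<epsilon> / cmod z + (3 + cmod z) * indicator D \<omega>)"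
    using intU intT intD AE_bound by (intro integral_mono_AE) auto
  also have "\<dots> = 2 * \<epsilon> / cmod z + (3 + cmod z) * measure M D"
    using indD by (simp add: prob_space)
  finally show ?thesis
    unfolding U_def D_def P_def .
qed

lemma tendsto_char_sum:
  fixes F :: "nat \<Rightarrow> nat \<Rightarrow> 'a measure" and X :: "nat \<Rightarrow> nat \<Rightarrow> 'a \<Rightarrow> real" and z :: complex
  assumes "prob_space M" and "\<And>n. filtration (space M) (F n)" and "\<And>n j. subalgebra M (F n j)"
    and "\<And>n j. j \<ge> 1 \<Longrightarrow> X n j \<in> borel_measurable (F n j)"
    and "\<And>n. A n \<in> borel_measurable M" and "z \<noteq> 0"
    and lim: "tendsto_in_prob M (\<lambda>n \<omega>. (\<Prod>j=1..k n. cond_char M (F n (j - 1)) (X n j) \<theta> \<omega>)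
      * exp (- (\<i> * of_real (\<theta> * A n \<omega>)))) z"
  shows "(\<lambda>n. LINT \<omega>|M. iexp (\<theta> * ((\<Sum>j=1..k n. X n j \<omega>) - A n \<omega>))) \<longlonglongrightarrow> z"
proof (rule tendstoI)
  fix e :: real assume "e > 0"
  \<comment> \<open>The first bound is the one required by \<open>char_sum_near\<close>; the second
    makes its deterministic term at most \<open>e / 2\<close> and leaves \<open>e / 2\<close> for
    the probability.\<close>
  define \<epsilon> where "\<epsilon> = min (cmod z / 2) (e * cmod z / 4)"
  have \<epsilon>: "\<epsilon> > 0" "\<epsilon> \<le> cmod z / 2" and "2 * \<epsilon> / cmod z \<le> e / 2"
    using \<open>e > 0\<close> \<open>z \<noteq> 0\<close> by (auto simp: \<epsilon>_def min_def field_simps)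
  let ?p = "\<lambda>n. measure M {\<omega> \<in> space M. dist ((\<Prod>j=1..k n. cond_char M (F n (j - 1)) (X n j) \<theta> \<omega>)
      * exp (- (\<i> * of_real (\<theta> * A n \<omega>)))) z > \<epsilon>}"
  have "?p \<longlonglongrightarrow> 0"
    using lim \<open>\<epsilon> > 0\<close> by (simp add: tendsto_in_prob_def)
  then have "(\<lambda>n. (3 + cmod z) * ?p n) \<longlonglongrightarrow> (3 + cmod z) * 0"
    by (rule tendsto_mult_left)
  then have "\<forall>\<^sub>F n in sequentially. (3 + cmod z) * ?p n < e / 2"
    using \<open>e > 0\<close> by (intro order_tendstoD) auto
  then show "\<forall>\<^sub>F n in sequentially.
      dist (LINT \<omega>|M. iexp (\<theta> * ((\<Sum>j=1..k n. X n j \<omega>) - A n \<omega>))) z < e"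
  proof eventually_elim
    case (elim n)
    then show ?case
      using char_sum_near[OF assms(1) assms(2)[of n] assms(3)[of n] assms(4)[of _ n] assms(5)[of n] \<epsilon>,
          of \<theta> "k n"] \<open>2 * \<epsilon> / cmod z \<le> e / 2\<close>
      by (simp add: dist_norm)
  qed
qed

section \<open>The equivalence and the limit in distribution\<close>

theorem theoremA3:
  fixes M :: "'a measure"
    and F :: "nat \<Rightarrow> nat \<Rightarrow> 'a measure"
    and X :: "nat \<Rightarrow> nat \<Rightarrow> 'a \<Rightarrow> real"
    and A :: "nat \<Rightarrow> 'a \<Rightarrow> real"
    and k :: "nat \<Rightarrow> nat"
    and \<Phi> :: "real \<Rightarrow> complex"
  defines "S \<equiv> \<lambda>\<theta> n \<omega>. (\<Sum>j=1..k n. cond_char M (F n (j - 1)) (X n j) \<theta> \<omega> - 1)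
                          - \<i> * of_real (\<theta> * A n \<omega>)"
    and "P \<equiv> \<lambda>\<theta> n \<omega>. (\<Prod>j=1..k n. cond_char M (F n (j - 1)) (X n j) \<theta> \<omega>)
                          * exp (- (\<i> * of_real (\<theta> * A n \<omega>)))"
  assumes "prob_space M"
    and "\<And>n. filtration (space M) (F n)"
    and "\<And>n j. subalgebra M (F n j)"
    and "\<And>n j. j \<ge> 1 \<Longrightarrow> X n j \<in> borel_measurable (F n j)"
    and "\<And>n. A n \<in> borel_measurable M"
    and "\<And>n. k n > 0"
    and "filterlim k at_top sequentially"
    and "\<And>\<theta>. tendsto_in_prob M
           (\<lambda>n \<omega>. \<Sum>j=1..k n. (cmod (1 - cond_char M (F n (j - 1)) (X n j) \<theta> \<omega>))\<^sup>2) 0"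
  shows
    "(\<forall>\<theta>.
        (tendsto_in_prob M (S \<theta>) (\<Phi> \<theta>) \<longrightarrow> tendsto_in_prob M (P \<theta>) (exp (\<Phi> \<theta>))) \<and>
        (tendsto_in_prob_mod_2pii M (S \<theta>) (\<Phi> \<theta>) \<longleftrightarrow> tendsto_in_prob M (P \<theta>) (exp (\<Phi> \<theta>))) \<and>
        (tendsto_in_prob M (S \<theta>) (\<Phi> \<theta>) \<or> tendsto_in_prob M (P \<theta>) (exp (\<Phi> \<theta>)) \<longrightarrow>
          (\<lambda>n. LINT \<omega>|M. iexp (\<theta> * ((\<Sum>j=1..k n. X n j \<omega>) - A n \<omega>))) \<longlonglongrightarrow> exp (\<Phi> \<theta>))) \<and>
     (\<forall>\<mu>. real_distribution \<mu> \<and> (\<forall>\<theta>. exp (\<Phi> \<theta>) = char \<mu> \<theta>) \<and>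
        ((\<forall>\<theta>. tendsto_in_prob M (S \<theta>) (\<Phi> \<theta>)) \<or>
         (\<forall>\<theta>. tendsto_in_prob M (P \<theta>) (exp (\<Phi> \<theta>)))) \<longrightarrow>
        weak_conv_m (\<lambda>n. distr M borel (\<lambda>\<omega>. (\<Sum>j=1..k n. X n j \<omega>) - A n \<omega>)) \<mu>)"
proof -
  interpret prob_space M by fact
  have \<phi>: "cond_char M (F n (j - 1)) (X n j) \<theta> \<in> borel_measurable M" for n j \<theta>
    unfolding cond_char_def using assms(3,5)
    by (intro measurable_from_subalg[OF _ borel_measurable_complex_cond_exp])
  have A [measurable]: "A n \<in> borel_measurable M" for n
    by fact
  have ab: "tendsto_in_prob_mod_2pii M (S \<theta>) (\<Phi> \<theta>) \<longleftrightarrow> tendsto_in_prob M (P \<theta>) (exp (\<Phi> \<theta>))" for \<theta>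
    unfolding S_def P_def
    by (rule sum_mod_2pii_iff_prod_tendsto_in_prob[OF \<open>prob_space M\<close> _ \<phi>]) (use assms(10) in auto)
  have a: "tendsto_in_prob M (P \<theta>) (exp (\<Phi> \<theta>))" if "tendsto_in_prob M (S \<theta>) (\<Phi> \<theta>)" for \<theta>
  proof -
    \<comment> \<open>Literal convergence is the case where every multiple of the period is
      zero.\<close>
    have "tendsto_in_prob_mod_2pii M (S \<theta>) (\<Phi> \<theta>)"
      unfolding tendsto_in_prob_mod_2pii_def
      using that by (intro exI[of _ "\<lambda>_ _. 0"]) simp
    then show ?thesis
      by (simp add: ab)
  qed
  have char_lim: "(\<lambda>n. LINT \<omega>|M. iexp (\<theta> * ((\<Sum>j=1..k n. X n j \<omega>) - A n \<omega>))) \<longlonglongrightarrow> exp (\<Phi> \<theta>)"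
    if "tendsto_in_prob M (P \<theta>) (exp (\<Phi> \<theta>))" for \<theta>
    \<comment> \<open>The condition \<open>z \<noteq> 0\<close> holds since \<open>exp\<close> never
      vanishes.\<close>
    using that unfolding P_def by (intro tendsto_char_sum[where F=F] assms) auto
  have "weak_conv_m (\<lambda>n. distr M borel (\<lambda>\<omega>. (\<Sum>j=1..k n. X n j \<omega>) - A n \<omega>)) \<mu>"
    if \<mu>: "real_distribution \<mu>" "\<And>\<theta>. exp (\<Phi> \<theta>) = char \<mu> \<theta>"
      and P: "\<And>\<theta>. tendsto_in_prob M (P \<theta>) (exp (\<Phi> \<theta>))" for \<mu>
  \<comment> \<open>Levy's theorem asks for convergence of the characteristic functions at every
    argument, which is \<open>char_lim\<close> with \<open>\<theta>\<close> as that
    argument.\<close>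
  proof (rule levy_continuity)
    have "(\<lambda>\<omega>. \<Sum>j=1..k n. X n j \<omega>) \<in> borel_measurable M" for n
      by (rule borel_measurable_sum, rule measurable_from_subalg[OF assms(5) assms(6)]) auto
    then have Y [measurable]: "(\<lambda>\<omega>. (\<Sum>j=1..k n. X n j \<omega>) - A n \<omega>) \<in> borel_measurable M" for n
      by measurable
    show "real_distribution (distr M borel (\<lambda>\<omega>. (\<Sum>j=1..k n. X n j \<omega>) - A n \<omega>))" for n
      by (rule real_distribution_distr) measurable
    have "char (distr M borel (\<lambda>\<omega>. (\<Sum>j=1..k n. X n j \<omega>) - A n \<omega>)) t =
        (LINT \<omega>|M. iexp (t * ((\<Sum>j=1..k n. X n j \<omega>) - A n \<omega>)))" for n t
      unfolding char_def by (rule integral_distr[OF Y]) measurable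
    then show "(\<lambda>n. char (distr M borel (\<lambda>\<omega>. (\<Sum>j=1..k n. X n j \<omega>) - A n \<omega>)) t) \<longlonglongrightarrow> char \<mu> t" for t
      using char_lim[OF P, of t] \<mu>(2)[of t] by simp
  qed (rule \<mu>(1))
  then show ?thesis
    using ab a char_lim by blast
qed

end
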